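(* Every $2$-tree decomposition $\mathcal{G}=(G;T_1,T_2)$ has a realisation in the plane $\mathbb{R}^2$.
   Context: A multi-graph is finite and loop-free, possibly with parallel edges. A $2$-tree decomposition is a tuple $(G;T_1,T_2)$ where $G$ is a multi-graph and $T_1,T_2$ are spanning trees of $G$ whose edge sets partition $E(G)$ (distinct parallel edges are distinct edges); the one-vertex edgeless graph with edgeless trees is included. Realisations: for $x\in\mathbb{R}^d$, $\|x\|_\infty=\max_i|x\cdot e_i|$. A framework $(G,p)$ in $\mathbb{R}^d$ consists of a multi-graph $G$ and an injective map $p:V(G)\to\mathbb{R}^d$. If $u,w$ are joined by exactly $t\ge1$ edges ($t\le d$), the pair $\{p(u),p(w)\}$ is well-positioned if there are exactly $t$ distinct indices $k\in\{1,\dots,d\}$ with $\|p(u)-p(w)\|_\infty=|(p(u)-p(w))\cdot e_k|$; these indices are the framework colours of the pair. $(G,p)$ is well-positioned if every adjacent pair is well-positioned; a framework colouring $\kappa_p:E(G)\to\{1,\dots,d\}$ then assigns to the $t$ edges between $u,w$ the $t$ framework colours of $\{p(u),p(w)\}$ bijectively. A realisation of a $d$-tree decomposition $(G;T_1,\dots,T_d)$ is a well-positioned framework $(G,p)$ in $\mathbb{R}^d$ such that for some framework colouring $\kappa_p$, $\kappa_p^{-1}(i)=E(T_i)$ for each $i$. *)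

theory Defs
  imports "HOL-Analysis.Analysis"
begin

definition multigraph :: "'v set \<Rightarrow> 'e set \<Rightarrow> ('e \<Rightarrow> 'v set) \<Rightarrow> bool" where
  "multigraph V E ends \<longleftrightarrow> finite V \<and> finite E \<and>
     (\<forall>e\<in>E. ends e \<subseteq> V \<and> card (ends e) = 2)"

definition adj_in :: "('e \<Rightarrow> 'v set) \<Rightarrow> 'e set \<Rightarrow> 'v \<Rightarrow> 'v \<Rightarrow> bool" where
  "adj_in ends F u w \<longleftrightarrow> (\<exists>e\<in>F. ends e = {u, w})"

definition connected_in :: "('e \<Rightarrow> 'v set) \<Rightarrow> 'e set \<Rightarrow> 'v \<Rightarrow> 'v \<Rightarrow> bool" where
  "connected_in ends F u w \<longleftrightarrow> (adj_in ends F)\<^sup>*\<^sup>* u w"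

text \<open>A spanning tree of the multigraph (V,E): an edge set T \<subseteq> E such that (V,T) is
  a tree, i.e. nonempty, connected, and acyclic (every edge of T is a bridge of (V,T);
  in particular T contains no two parallel edges).\<close>
definition spanning_tree :: "'v set \<Rightarrow> 'e set \<Rightarrow> ('e \<Rightarrow> 'v set) \<Rightarrow> 'e set \<Rightarrow> bool" where
  "spanning_tree V E ends T \<longleftrightarrow> T \<subseteq> E \<and> V \<noteq> {} \<and>
     (\<forall>u\<in>V. \<forall>w\<in>V. connected_in ends T u w) \<and>
     (\<forall>e\<in>T. \<forall>u w. ends e = {u, w} \<longrightarrow> \<not> connected_in ends (T - {e}) u w)"

definition tree_decomposition ::
  "'v set \<Rightarrow> 'e set \<Rightarrow> ('e \<Rightarrow> 'v set) \<Rightarrow> ('d::finite \<Rightarrow> 'e set) \<Rightarrow> bool" where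
  "tree_decomposition V E ends T \<longleftrightarrow> multigraph V E ends \<and>
     (\<forall>i. spanning_tree V E ends (T i)) \<and>
     (\<forall>i j. i \<noteq> j \<longrightarrow> T i \<inter> T j = {}) \<and>
     (\<Union>i. T i) = E"

definition linf :: "real^'d::finite \<Rightarrow> real" where
  "linf x = Max (range (\<lambda>i. \<bar>x $ i\<bar>))"

definition framework_colours :: "real^'d::finite \<Rightarrow> real^'d \<Rightarrow> 'd set" where
  "framework_colours x y = {k. linf (x - y) = \<bar>(x - y) $ k\<bar>}"

definition edges_between :: "'e set \<Rightarrow> ('e \<Rightarrow> 'v set) \<Rightarrow> 'v \<Rightarrow> 'v \<Rightarrow> 'e set" where
  "edges_between E ends u w = {e\<in>E. ends e = {u, w}}"

definition well_positioned ::
  "'v set \<Rightarrow> 'e set \<Rightarrow> ('e \<Rightarrow> 'v set) \<Rightarrow> ('v \<Rightarrow> real^'d::finite) \<Rightarrow> bool" where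
  "well_positioned V E ends p \<longleftrightarrow>
     (\<forall>u\<in>V. \<forall>w\<in>V. u \<noteq> w \<longrightarrow> edges_between E ends u w \<noteq> {} \<longrightarrow>
        card (framework_colours (p u) (p w)) = card (edges_between E ends u w))"

definition framework_colouring ::
  "'v set \<Rightarrow> 'e set \<Rightarrow> ('e \<Rightarrow> 'v set) \<Rightarrow> ('v \<Rightarrow> real^'d::finite) \<Rightarrow> ('e \<Rightarrow> 'd) \<Rightarrow> bool" where
  "framework_colouring V E ends p \<kappa> \<longleftrightarrow>
     (\<forall>u\<in>V. \<forall>w\<in>V. u \<noteq> w \<longrightarrow> edges_between E ends u w \<noteq> {} \<longrightarrow>
        bij_betw \<kappa> (edges_between E ends u w) (framework_colours (p u) (p w)))"

definition realisation ::
  "'v set \<Rightarrow> 'e set \<Rightarrow> ('e \<Rightarrow> 'v set) \<Rightarrow> ('d::finite \<Rightarrow> 'e set) \<Rightarrow> ('v \<Rightarrow> real^'d) \<Rightarrow> bool" where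
  "realisation V E ends T p \<longleftrightarrow> inj_on p V \<and> well_positioned V E ends p \<and>
     (\<exists>\<kappa>. framework_colouring V E ends p \<kappa> \<and> (\<forall>i. {e\<in>E. \<kappa> e = i} = T i))"

end

theory Submission
  imports Defs
begin

text \<open>In the rotated coordinates a = x + y and b = x - y, a realisation is an injective placement
  such that the differences in a and b have the same sign along edges of the first tree only,
  opposite signs along edges of the second tree only, and exactly one of them vanishes along
  double edges. We induct on the number of vertices. As the degrees sum to less than 4 |V|, some
  vertex v is a leaf of one tree, say the second, with neighbour w there, and has degree at most 2
  in the other. If v is a leaf of both trees, delete it and put it back. If v has neighbours u1, u2
  in the first tree, delete v and reconnect the first tree by {u1, u2}. When {u1, u2} is not an edge
  of the second tree, the points u1, u2 are concordant and v fits back in. Otherwise {u1, u2} has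
  become a double edge, which is made discordant by shifting one coordinate of a component of the
  first tree. Then v fits back in as soon as w lies outside the box spanned by u1, u2, and this can
  be arranged because the second tree contains no triangle.\<close>

section \<open>Trees as edge sets\<close>

definition joined :: "'v set set \<Rightarrow> 'v \<Rightarrow> 'v \<Rightarrow> bool" where
  "joined F = (\<lambda>x y. {x, y} \<in> F)\<^sup>*\<^sup>*"

text \<open>Trees are described by connectivity and edge count, the two facts that are easy to
  maintain when a vertex is deleted; \<open>stree_bridge\<close> recovers acyclicity. Edges are
  vertex pairs, so a double edge of the multi-graph appears as a pair lying in both trees.\<close>

definition stree :: "'v set \<Rightarrow> 'v set set \<Rightarrow> bool" where
  "stree V F \<longleftrightarrow> finite V \<and> V \<noteq> {} \<and> (\<forall>e\<in>F. e \<subseteq> V \<and> card e = 2) \<and>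
     (\<forall>u\<in>V. \<forall>w\<in>V. joined F u w) \<and> card F + 1 = card V"

lemma joined_refl [simp]: "joined F x x"
  by (simp add: joined_def)

lemma joined_edge: "{x, y} \<in> F \<Longrightarrow> joined F x y"
  by (simp add: joined_def r_into_rtranclp)

lemma joined_trans: "joined F x y \<Longrightarrow> joined F y z \<Longrightarrow> joined F x z"
  by (auto simp: joined_def)

lemma joined_sym: "joined F x y \<Longrightarrow> joined F y x"
proof -
  have "symp (\<lambda>x y. {x, y} \<in> F)" by (auto simp: symp_def insert_commute)
  then show "joined F x y \<Longrightarrow> joined F y x"
    unfolding joined_def by (meson sympD symp_rtranclp)
qed

text \<open>Replaces each edge of a walk by a walk. With \<open>f\<close> sending a deleted vertex
  to one of its neighbours, it transfers connectivity to the tree without that vertex.\<close>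

lemma joined_map:
  assumes "\<And>x y. {x, y} \<in> F \<Longrightarrow> joined G (f x) (f y)" and "joined F x y"
  shows "joined G (f x) (f y)"
  using assms(2) unfolding joined_def[of F]
  by (induction rule: rtranclp_induct) (auto intro: joined_trans assms(1))

lemma joined_mono: "joined F x y \<Longrightarrow> F \<subseteq> G \<Longrightarrow> joined G x y"
  using joined_map[of F G "\<lambda>x. x"] joined_edge[of _ _ G] by blast

lemma joined_exit:
  assumes "joined F x y" "x \<in> U" "y \<notin> U"
  shows "\<exists>u\<in>U. \<exists>w. w \<notin> U \<and> {u, w} \<in> F"
proof (rule ccontr)
  assume *: "\<not> ?thesis"
  have "y \<in> U" using assms(1,2) unfolding joined_def
    by (induction rule: rtranclp_induct) (use * in auto)
  then show False using assms(3) by simp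
qed

section \<open>Spanning subsets and bridges\<close>

text \<open>Grow a vertex set \<open>U\<close> from a single vertex: as long as \<open>U\<close> is
  not all of \<open>V\<close>, a walk to a missing vertex supplies an edge leaving \<open>U\<close>,
  and adding it brings in one vertex and one edge.\<close>

lemma ex_spanning_subset:
  assumes "finite V" "V \<noteq> {}" and F: "\<And>e. e \<in> F \<Longrightarrow> e \<subseteq> V"
    and conn: "\<And>u w. u \<in> V \<Longrightarrow> w \<in> V \<Longrightarrow> joined F u w"
  shows "\<exists>S\<subseteq>F. (\<forall>u\<in>V. \<forall>w\<in>V. joined S u w) \<and> card S + 1 = card V"
proof -
  have *: "Suc k \<le> card V \<Longrightarrow> \<exists>U S. U \<subseteq> V \<and> card U = Suc k \<and> S \<subseteq> F \<and> finite S \<and> (\<forall>e\<in>S. e \<subseteq> U) \<and>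
      (\<forall>u\<in>U. \<forall>w\<in>U. joined S u w) \<and> card S = k" for k
  proof (induction k)
    case 0
    obtain x where "x \<in> V" using assms(2) by auto
    then show ?case by (intro exI[of _ "{x}"] exI[of _ "{}"]) auto
  next
    case (Suc k)
    then obtain U S where U: "U \<subseteq> V" "card U = Suc k" and S: "S \<subseteq> F" "finite S" "\<forall>e\<in>S. e \<subseteq> U"
      "\<forall>u\<in>U. \<forall>w\<in>U. joined S u w" "card S = k" by auto
    have finU: "finite U" using U(1) assms(1) finite_subset by blast
    obtain x where x: "x \<in> U" using U(2) by fastforce
    have "U \<noteq> V" using U(2) Suc.prems by auto
    then obtain y where "y \<in> V" "y \<notin> U" using U(1) by blast
    then obtain u w where e: "u \<in> U" "w \<notin> U" "{u, w} \<in> F"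
      using joined_exit[OF conn x] x U(1) by blast
    let ?S = "insert {u, w} S"
    have "{u, w} \<notin> S" using S(3) e(2) by auto
    then have "card ?S = Suc k" using S by simp
    moreover have ju: "joined ?S u z" if "z \<in> insert w U" for z
      using that S(4) e(1) by (auto intro: joined_edge joined_mono)
    have "\<forall>x\<in>insert w U. \<forall>z\<in>insert w U. joined ?S x z"
      using ju joined_sym joined_trans by metis
    moreover have "card (insert w U) = Suc (Suc k)" using finU e(2) U(2) by simp
    moreover have "insert w U \<subseteq> V" using F[OF e(3)] U(1) by auto
    moreover have "\<forall>e\<in>?S. e \<subseteq> insert w U" using S(3) e(1) by auto
    ultimately show ?case using S e
      by (intro exI[of _ "insert w U"] exI[of _ ?S]) blast
  qed
  have "card V > 0" using assms(1,2) by (simp add: card_gt_0_iff)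
  then obtain k where k: "card V = Suc k" using gr0_implies_Suc by blast
  obtain U S where US: "U \<subseteq> V" "card U = Suc k" "S \<subseteq> F"
      "\<forall>u\<in>U. \<forall>w\<in>U. joined S u w" "card S = k" using *[of k] k by auto
  have "U = V" using US(1,2) k assms(1) card_subset_eq by metis
  then show ?thesis using US k by auto
qed

lemma stree_finite_edges: "stree V F \<Longrightarrow> finite F"
  unfolding stree_def by (intro finite_subset[of F "Pow V"]) auto

text \<open>If an edge could be bypassed, the remaining edges would still connect \<open>V\<close>
  and so contain a spanning subset with as many edges as \<open>F\<close> has, which is too
  many.\<close>

lemma stree_bridge:
  assumes t: "stree V F" and e: "{x, y} \<in> F"
  shows "\<not> joined (F - {{x, y}}) x y"
proof
  let ?G = "F - {{x, y}}"
  assume j: "joined ?G x y"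
  have "joined ?G (id u) (id w)" if "joined F u w" for u w
  proof (rule joined_map[OF _ that])
    fix p q assume pq: "{p, q} \<in> F"
    show "joined ?G (id p) (id q)"
      using j joined_sym[OF j] pq
      by (cases "{p, q} = {x, y}") (auto simp: doubleton_eq_iff intro: joined_edge)
  qed
  then have "\<exists>S\<subseteq>?G. (\<forall>u\<in>V. \<forall>w\<in>V. joined S u w) \<and> card S + 1 = card V"
    using t by (intro ex_spanning_subset) (auto simp: stree_def)
  then obtain S where "S \<subseteq> ?G" "card S + 1 = card V" by blast
  then have "card F \<le> card ?G" 
    using t stree_finite_edges[OF t] by (metis card_mono finite_Diff stree_def add_right_cancel)
  then show False using e stree_finite_edges[OF t] by (metis card_Diff1_less not_le)
qed

section \<open>Deleting a vertex of degree one or two\<close>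

lemma incident_cases:
  assumes "{e\<in>F. v \<in> e} = {{v, u1}, {v, u2}}" and "{p, q} \<in> F"
  obtains "v \<notin> {p, q}" | "p = v" "q = u1" | "p = v" "q = u2" | "p = u1" "q = v" | "p = u2" "q = v"
proof (cases "v \<in> {p, q}")
  case True
  then have "{p, q} \<in> {e\<in>F. v \<in> e}" using assms(2) by simp
  then show thesis using that unfolding assms(1) by (auto simp: doubleton_eq_iff)
qed (use that in auto)

lemma incident_mem:
  assumes "{e\<in>F. v \<in> e} = {{v, u1}, {v, u2}}"
  shows "{v, u1} \<in> F" "{v, u2} \<in> F"
    and "F = insert {v, u1} (insert {v, u2} {e\<in>F. v \<notin> e})"
proof -
  have "{v, u1} \<in> {e\<in>F. v \<in> e}" "{v, u2} \<in> {e\<in>F. v \<in> e}" unfolding assms by simp_all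
  then show "{v, u1} \<in> F" "{v, u2} \<in> F" by simp_all
  have "F = {e\<in>F. v \<in> e} \<union> {e\<in>F. v \<notin> e}" by auto
  also have "\<dots> = insert {v, u1} (insert {v, u2} {e\<in>F. v \<notin> e})" unfolding assms by simp
  finally show "F = insert {v, u1} (insert {v, u2} {e\<in>F. v \<notin> e})" .
qed

lemma stree_leaf:
  assumes t: "stree V F" and v: "v \<in> V" and u: "u \<noteq> v" and inc: "{e\<in>F. v \<in> e} = {{v, u}}"
  shows "stree (V - {v}) {e\<in>F. v \<notin> e}"
proof -
  \<comment> \<open>\<open>?f\<close> retracts \<open>v\<close> onto its neighbour \<open>u\<close>:
    the edge \<open>{v, u}\<close> becomes a trivial walk and all other edges stay.\<close>
  let ?G = "{e\<in>F. v \<notin> e}" and ?f = "\<lambda>x. if x = v then u else x"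
  have inc2: "{e\<in>F. v \<in> e} = {{v, u}, {v, u}}" using inc by simp
  have *: "joined ?G (?f x) (?f y)" if "joined F x y" for x y
  proof (rule joined_map[OF _ that])
    fix p q assume pq: "{p, q} \<in> F"
    show "joined ?G (?f p) (?f q)"
      using pq by (cases rule: incident_cases[OF inc2 pq]) (auto intro: joined_edge)
  qed
  have conn: "\<forall>x\<in>V - {v}. \<forall>y\<in>V - {v}. joined ?G x y"
  proof (intro ballI)
    fix x y assume "x \<in> V - {v}" "y \<in> V - {v}"
    then show "joined ?G x y" using *[of x y] t by (simp add: stree_def)
  qed
  have "{v, u} \<notin> ?G" "finite ?G" using stree_finite_edges[OF t] by auto
  moreover have "F = insert {v, u} ?G" using incident_mem(3)[OF inc2] by simp
  ultimately have "card F = card ?G + 1" by (metis card_insert_disjoint Suc_eq_plus1)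
  moreover have "u \<in> V" using incident_mem(1)[OF inc2] t by (auto simp: stree_def)
  then have "V - {v} \<noteq> {}" using u by auto
  moreover have "card (V - {v}) + 1 = card V" using t v by (metis card_Suc_Diff1 stree_def Suc_eq_plus1)
  moreover have "\<forall>e\<in>?G. e \<subseteq> V - {v} \<and> card e = 2" using t by (auto simp: stree_def)
  ultimately show ?thesis using t conn unfolding stree_def by simp
qed

text \<open>A walk from \<open>u1\<close> to \<open>u2\<close> avoiding \<open>v\<close>, continued
  by the edge from \<open>u2\<close> to \<open>v\<close>, would bypass the bridge
  \<open>{v, u1}\<close>.\<close>

lemma stree_split_separated:
  assumes t: "stree V F" and u: "u1 \<noteq> v" "u2 \<noteq> v" "u1 \<noteq> u2"
    and inc: "{e\<in>F. v \<in> e} = {{v, u1}, {v, u2}}"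
  shows "\<not> joined {e\<in>F. v \<notin> e} u1 u2"
proof
  assume j: "joined {e\<in>F. v \<notin> e} u1 u2"
  note F = incident_mem(1,2)[OF inc]
  have "joined (F - {{v, u1}}) u1 u2" by (rule joined_mono[OF j]) auto
  moreover have "joined (F - {{v, u1}}) u2 v"
    using F u by (intro joined_edge) (auto simp: doubleton_eq_iff insert_commute)
  ultimately show False
    using stree_bridge[OF t F(1)] joined_sym joined_trans by metis
qed

text \<open>Follow a walk from \<open>v\<close> to \<open>x\<close>: whenever it leaves
  \<open>v\<close> it enters \<open>u1\<close> or \<open>u2\<close>, and until it returns it stays
  on that side.\<close>

lemma stree_split_sides:
  assumes t: "stree V F" and v: "v \<in> V"
    and inc: "{e\<in>F. v \<in> e} = {{v, u1}, {v, u2}}" and x: "x \<in> V" "x \<noteq> v"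
  shows "joined {e\<in>F. v \<notin> e} u1 x \<or> joined {e\<in>F. v \<notin> e} u2 x"
proof -
  let ?G = "{e\<in>F. v \<notin> e}"
  have "joined F v x" using t v x by (auto simp: stree_def)
  then have "x = v \<or> joined ?G u1 x \<or> joined ?G u2 x"
    unfolding joined_def[of F]
  proof (induction rule: rtranclp_induct)
    case (step y z)
    from step(2) show ?case
    proof (cases rule: incident_cases[OF inc step(2)])
      case 1
      then have "joined ?G y z" using step(2) by (intro joined_edge) simp
      then show ?thesis using step(3) 1 joined_trans[of ?G _ y z] by auto
    qed auto
  qed auto
  then show ?thesis using x by simp
qed

text \<open>Without \<open>v\<close> the tree falls into the sides of \<open>u1\<close> and
  \<open>u2\<close>, and an edge from any \<open>x\<close> on the first side to \<open>u2\<close>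
  reconnects them. Two edges go and one comes, matching the loss of one vertex. Later
  \<open>x\<close> is either \<open>u1\<close> or \<open>w\<close>.\<close>

lemma stree_split:
  assumes t: "stree V F" and v: "v \<in> V" and u: "u1 \<noteq> v" "u2 \<noteq> v" "u1 \<noteq> u2"
    and inc: "{e\<in>F. v \<in> e} = {{v, u1}, {v, u2}}"
    and x: "x \<in> V" "x \<noteq> v" "joined {e\<in>F. v \<notin> e} u1 x"
  shows "stree (V - {v}) (insert {x, u2} {e\<in>F. v \<notin> e})" and "{x, u2} \<notin> F" and "x \<noteq> u2"
proof -
  let ?G = "{e\<in>F. v \<notin> e}" and ?f = "\<lambda>x. if x = v then u1 else x"
  let ?H = "insert {x, u2} ?G"
  note sep = stree_split_separated[OF t u inc]
  show xu2: "x \<noteq> u2" using sep x(3) by auto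
  show nF: "{x, u2} \<notin> F"
  proof
    assume "{x, u2} \<in> F"
    then have "joined ?G x u2" using x(2) u by (intro joined_edge) auto
    then show False using sep joined_trans[OF x(3)] by blast
  qed
  have "joined ?H u1 x" by (rule joined_mono[OF x(3)]) auto
  \<comment> \<open>Once \<open>v\<close> is retracted onto \<open>u1\<close>, the edge
    \<open>{v, u2}\<close> has to be replaced by this detour from \<open>u1\<close> through
    \<open>x\<close> to \<open>u2\<close>.\<close>
  then have j12: "joined ?H u1 u2" by (rule joined_trans) (simp add: joined_edge)
  have *: "joined ?H (?f p) (?f q)" if "joined F p q" for p q
  proof (rule joined_map[OF _ that])
    fix p q assume pq: "{p, q} \<in> F"
    show "joined ?H (?f p) (?f q)"
      using pq j12 joined_sym[OF j12] u
      by (cases rule: incident_cases[OF inc pq]) (auto intro: joined_edge)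
  qed
  have conn: "\<forall>p\<in>V - {v}. \<forall>q\<in>V - {v}. joined ?H p q"
  proof (intro ballI)
    fix p q assume "p \<in> V - {v}" "q \<in> V - {v}"
    then show "joined ?H p q" using *[of p q] t by (simp add: stree_def)
  qed
  have fG: "finite ?G" using stree_finite_edges[OF t] by simp
  have "{v, u1} \<notin> insert {v, u2} ?G" "{v, u2} \<notin> ?G" using u by (auto simp: doubleton_eq_iff)
  then have "card (insert {v, u1} (insert {v, u2} ?G)) = card ?G + 2" using fG by simp
  then have "card F = card ?G + 2" using incident_mem(3)[OF inc] by simp
  moreover have "card ?H = card ?G + 1" using nF fG by simp
  moreover have "card (V - {v}) + 1 = card V" using t v by (metis card_Suc_Diff1 stree_def Suc_eq_plus1)
  moreover have "V - {v} \<noteq> {}" using x by auto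
  moreover have "u2 \<in> V" using incident_mem(2)[OF inc] t by (auto simp: stree_def)
  then have "\<forall>e\<in>?H. e \<subseteq> V - {v} \<and> card e = 2" using t x u xu2 by (auto simp: stree_def)
  ultimately show "stree (V - {v}) ?H" using t conn unfolding stree_def by simp
qed

section \<open>Degree counting\<close>

lemma stree_incident_nonempty:
  assumes t: "stree V F" and v: "v \<in> V" and "card V \<ge> 2"
  shows "card {e\<in>F. v \<in> e} \<ge> 1"
proof -
  have "V \<noteq> {v}" using assms(3) by auto
  then obtain y where "y \<in> V" "y \<noteq> v" using v by blast
  then have "joined F v y" using t v by (auto simp: stree_def)
  then obtain w where "{v, w} \<in> F" using joined_exit[of F v y "{v}"] \<open>y \<noteq> v\<close> by auto
  then have "{e\<in>F. v \<in> e} \<noteq> {}" by auto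
  then show ?thesis using stree_finite_edges[OF t] by (simp add: Suc_le_eq card_gt_0_iff)
qed

lemma stree_degree_sum:
  assumes t: "stree V F"
  shows "(\<Sum>v\<in>V. card {e\<in>F. v \<in> e}) = 2 * card F"
proof (rule sum_multicount)
  show "finite V" "finite F" using t stree_finite_edges by (auto simp: stree_def)
  show "\<forall>e\<in>F. card {v\<in>V. v \<in> e} = 2"
  proof
    fix e assume "e \<in> F"
    then have "{v\<in>V. v \<in> e} = e" "card e = 2" using t by (auto simp: stree_def)
    then show "card {v\<in>V. v \<in> e} = 2" by simp
  qed
qed

text \<open>By the handshake count the two trees together have degree sum
  \<open>4 * card V - 4\<close>, so the average is below four.\<close>

lemma ex_low_degree:
  assumes t: "stree V E1" "stree V E2"
  shows "\<exists>v\<in>V. card {e\<in>E1. v \<in> e} + card {e\<in>E2. v \<in> e} \<le> 3"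
proof (rule ccontr)
  assume "\<not> ?thesis"
  then have "\<And>v. v \<in> V \<Longrightarrow> 4 \<le> card {e\<in>E1. v \<in> e} + card {e\<in>E2. v \<in> e}" by force
  then have "card V * 4 \<le> (\<Sum>v\<in>V. card {e\<in>E1. v \<in> e} + card {e\<in>E2. v \<in> e})"
    by (intro sum_bounded_below[of V "4::nat", simplified]) auto
  then show False using stree_degree_sum[OF t(1)] stree_degree_sum[OF t(2)] t
    by (simp add: sum.distrib stree_def)
qed

lemma incident_one:
  assumes t: "stree V F" and "card {e\<in>F. v \<in> e} = 1"
  obtains u where "u \<in> V" "u \<noteq> v" "{e\<in>F. v \<in> e} = {{v, u}}"
proof -
  obtain e where e: "{e\<in>F. v \<in> e} = {e}" using assms(2) card_1_singletonE by blast
  then have "e \<in> F" "v \<in> e" by auto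
  then have "card e = 2" "e \<subseteq> V" using t by (auto simp: stree_def)
  then obtain u where "e = {v, u}" "u \<noteq> v" using \<open>v \<in> e\<close> by (auto simp: card_2_iff)
  then show thesis using that e \<open>e \<subseteq> V\<close> by auto
qed

lemma incident_two:
  assumes t: "stree V F" and "card {e\<in>F. v \<in> e} = 2"
  obtains u1 u2 where "u1 \<in> V" "u2 \<in> V" "u1 \<noteq> v" "u2 \<noteq> v" "u1 \<noteq> u2"
    "{e\<in>F. v \<in> e} = {{v, u1}, {v, u2}}"
proof -
  obtain e e' where e: "{e\<in>F. v \<in> e} = {e, e'}" "e \<noteq> e'" using assms(2) by (auto simp: card_2_iff)
  then have "e \<in> F" "v \<in> e" "e' \<in> F" "v \<in> e'" by auto
  then have "card e = 2" "e \<subseteq> V" "card e' = 2" "e' \<subseteq> V" using t by (auto simp: stree_def)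
  then obtain u1 u2 where "e = {v, u1}" "u1 \<noteq> v" "e' = {v, u2}" "u2 \<noteq> v"
    using \<open>v \<in> e\<close> \<open>v \<in> e'\<close> by (auto simp: card_2_iff)
  then show thesis using that e \<open>e \<subseteq> V\<close> \<open>e' \<subseteq> V\<close> by auto
qed

section \<open>Planar layouts in rotated coordinates\<close>

text \<open>If the differences of \<open>a\<close> and \<open>b\<close> are s and t, the plane
  coordinates differ by s + t and s - t, and the sign of st tells which is larger in modulus.
  Injectivity ensures that a zero product has only one zero factor.\<close>

definition layout :: "'v set \<Rightarrow> 'v set set \<Rightarrow> 'v set set \<Rightarrow> ('v \<Rightarrow> real) \<Rightarrow> ('v \<Rightarrow> real) \<Rightarrow> bool" where
  "layout V E1 E2 a b \<longleftrightarrow> inj_on (\<lambda>v. (a v, b v)) V \<and>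
     (\<forall>u\<in>V. \<forall>w\<in>V. u \<noteq> w \<longrightarrow>
        ({u, w} \<in> E1 - E2 \<longrightarrow> 0 < (a u - a w) * (b u - b w)) \<and>
        ({u, w} \<in> E2 - E1 \<longrightarrow> (a u - a w) * (b u - b w) < 0) \<and>
        ({u, w} \<in> E1 \<inter> E2 \<longrightarrow> (a u - a w) * (b u - b w) = 0))"

lemma layoutD:
  assumes "layout V E1 E2 a b" "u \<in> V" "w \<in> V" "u \<noteq> w"
  shows "a u \<noteq> a w \<or> b u \<noteq> b w"
    and "{u, w} \<in> E1 \<Longrightarrow> {u, w} \<notin> E2 \<Longrightarrow> 0 < (a u - a w) * (b u - b w)"
    and "{u, w} \<in> E2 \<Longrightarrow> {u, w} \<notin> E1 \<Longrightarrow> (a u - a w) * (b u - b w) < 0"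
    and "{u, w} \<in> E1 \<Longrightarrow> {u, w} \<in> E2 \<Longrightarrow> (a u - a w) * (b u - b w) = 0"
  using assms unfolding layout_def inj_on_def by blast+

lemma layoutI:
  assumes "\<And>u w. u \<in> V \<Longrightarrow> w \<in> V \<Longrightarrow> u \<noteq> w \<Longrightarrow> a u \<noteq> a w \<or> b u \<noteq> b w"
    and "\<And>u w. u \<in> V \<Longrightarrow> w \<in> V \<Longrightarrow> u \<noteq> w \<Longrightarrow> {u, w} \<in> E1 \<Longrightarrow> {u, w} \<notin> E2 \<Longrightarrow> 0 < (a u - a w) * (b u - b w)"
    and "\<And>u w. u \<in> V \<Longrightarrow> w \<in> V \<Longrightarrow> u \<noteq> w \<Longrightarrow> {u, w} \<in> E2 \<Longrightarrow> {u, w} \<notin> E1 \<Longrightarrow> (a u - a w) * (b u - b w) < 0"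
    and "\<And>u w. u \<in> V \<Longrightarrow> w \<in> V \<Longrightarrow> u \<noteq> w \<Longrightarrow> {u, w} \<in> E1 \<Longrightarrow> {u, w} \<in> E2 \<Longrightarrow> (a u - a w) * (b u - b w) = 0"
  shows "layout V E1 E2 a b"
  unfolding layout_def using assms by (auto intro!: inj_onI)

text \<open>Exchanges the roles of the two trees, so that the leaf may be assumed to lie in the
  second one.\<close>

lemma layout_negate:
  assumes "layout V E1 E2 a b"
  shows "layout V E2 E1 a (\<lambda>v. - b v)"
proof (rule layoutI)
  fix u w assume uw: "u \<in> V" "w \<in> V" "u \<noteq> w"
  have neg: "(a u - a w) * (- b u - - b w) = - ((a u - a w) * (b u - b w))" by (simp add: algebra_simps)
  note L = layoutD[OF assms uw]
  show "a u \<noteq> a w \<or> - b u \<noteq> - b w" using L(1) by simp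
  show "{u, w} \<in> E2 \<Longrightarrow> {u, w} \<notin> E1 \<Longrightarrow> 0 < (a u - a w) * (- b u - - b w)" using L(3) neg by simp
  show "{u, w} \<in> E1 \<Longrightarrow> {u, w} \<notin> E2 \<Longrightarrow> (a u - a w) * (- b u - - b w) < 0" using L(2) neg by simp
  show "{u, w} \<in> E2 \<Longrightarrow> {u, w} \<in> E1 \<Longrightarrow> (a u - a w) * (- b u - - b w) = 0" using L(4) neg by simp
qed

text \<open>Exchanges the two coordinates, so that only ties in the first one have to be
  broken.\<close>

lemma layout_flip:
  assumes "layout V E1 E2 a b"
  shows "layout V E1 E2 b a"
  by (rule layoutI) (use layoutD[OF assms] in \<open>force simp: mult.commute\<close>)+

text \<open>An auxiliary edge outside \<open>E2\<close> can simply be forgotten. One inside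
  \<open>E2\<close> could not: its ends are tied, and afterwards they would have to be
  discordant.\<close>

lemma layout_drop_edge:
  "layout V (insert e E1) E2 a b \<Longrightarrow> e \<notin> E2 \<Longrightarrow> layout V E1 E2 a b"
  unfolding layout_def by blast

lemma layout_extend:
  assumes l: "layout (V - {v}) {e\<in>E1. v \<notin> e} {e\<in>E2. v \<notin> e} a b"
    and new: "\<And>x. x \<in> V - {v} \<Longrightarrow> \<alpha> \<noteq> a x \<or> \<beta> \<noteq> b x"
    and c: "\<And>x. x \<in> V - {v} \<Longrightarrow> {v, x} \<in> E1 \<Longrightarrow> {v, x} \<notin> E2 \<Longrightarrow> 0 < (\<alpha> - a x) * (\<beta> - b x)"
      "\<And>x. x \<in> V - {v} \<Longrightarrow> {v, x} \<in> E2 \<Longrightarrow> {v, x} \<notin> E1 \<Longrightarrow> (\<alpha> - a x) * (\<beta> - b x) < 0"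
      "\<And>x. x \<in> V - {v} \<Longrightarrow> {v, x} \<in> E1 \<Longrightarrow> {v, x} \<in> E2 \<Longrightarrow> (\<alpha> - a x) * (\<beta> - b x) = 0"
  shows "layout V E1 E2 (a(v := \<alpha>)) (b(v := \<beta>))"
proof (rule layoutI)
  note flip = minus_mult_minus[of "\<alpha> - a x" "\<beta> - b x" for x, simplified minus_diff_eq]
  fix u w assume uw: "u \<in> V" "w \<in> V" "u \<noteq> w"
  let ?a = "a(v := \<alpha>)" and ?b = "b(v := \<beta>)"
  consider "u = v" "w \<in> V - {v}" | "w = v" "u \<in> V - {v}" | "u \<in> V - {v}" "w \<in> V - {v}"
    using uw by blast
  then have "(?a u \<noteq> ?a w \<or> ?b u \<noteq> ?b w) \<and>
    ({u, w} \<in> E1 \<longrightarrow> {u, w} \<notin> E2 \<longrightarrow> 0 < (?a u - ?a w) * (?b u - ?b w)) \<and>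
    ({u, w} \<in> E2 \<longrightarrow> {u, w} \<notin> E1 \<longrightarrow> (?a u - ?a w) * (?b u - ?b w) < 0) \<and>
    ({u, w} \<in> E1 \<longrightarrow> {u, w} \<in> E2 \<longrightarrow> (?a u - ?a w) * (?b u - ?b w) = 0)"
  proof cases
    case 1
    then show ?thesis using new[of w] c[of w] by auto
  next
    case 2
    have "{u, w} = {v, u}" using 2 by auto
    then show ?thesis using 2 new[of u] c[of u] flip[of u] by auto
  next
    case 3
    then show ?thesis using layoutD[OF l 3 uw(3)] by auto
  qed
  then show "?a u \<noteq> ?a w \<or> ?b u \<noteq> ?b w"
    "{u, w} \<in> E1 \<Longrightarrow> {u, w} \<notin> E2 \<Longrightarrow> 0 < (?a u - ?a w) * (?b u - ?b w)"
    "{u, w} \<in> E2 \<Longrightarrow> {u, w} \<notin> E1 \<Longrightarrow> (?a u - ?a w) * (?b u - ?b w) < 0"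
    "{u, w} \<in> E1 \<Longrightarrow> {u, w} \<in> E2 \<Longrightarrow> (?a u - ?a w) * (?b u - ?b w) = 0"
    by blast+
qed

section \<open>Placing a new point\<close>

lemma real_between_avoiding:
  fixes l u :: real
  assumes "finite S" "l < u"
  obtains x where "l < x" "x < u" "x \<notin> S"
proof -
  have "\<not> {l<..<u} \<subseteq> S" using assms infinite_Ioo finite_subset by blast
  then obtain x where "x \<in> {l<..<u}" "x \<notin> S" by blast
  then show thesis using that[of x] by simp
qed

lemma real_above_avoiding:
  fixes l :: real
  assumes "finite S"
  obtains x where "l < x" "x \<notin> S"
  using real_between_avoiding[OF assms, of l "l + 1"] by auto

lemma real_below_avoiding:
  fixes u :: real
  assumes "finite S"
  obtains x where "x < u" "x \<notin> S"
  using real_between_avoiding[OF assms, of "u - 1" u] by auto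

text \<open>In a coordinate where the two points differ choose a value strictly between them, and in
  the other a value beyond both. \<open>S\<close> will hold the first coordinates in use, so that
  the new point is distinct from all others.\<close>

lemma place_two:
  fixes a1 b1 aw bw :: real
  assumes S: "finite S" and ne: "a1 \<noteq> aw \<or> b1 \<noteq> bw"
  shows "\<exists>\<alpha> \<beta>. \<alpha> \<notin> S \<and> 0 < (\<alpha> - a1) * (\<beta> - b1) \<and> (\<alpha> - aw) * (\<beta> - bw) < 0"
proof -
  consider "b1 < bw" | "bw < b1" | "a1 < aw" | "aw < a1" using ne by linarith
  then show ?thesis
  proof cases
    case 1
    obtain \<alpha> where "max a1 aw < \<alpha>" "\<alpha> \<notin> S"
      using real_above_avoiding[OF S] by blast
    then show ?thesis using 1
      by (intro exI[of _ \<alpha>] exI[of _ "(b1 + bw) / 2"]) (auto simp: zero_less_mult_iff mult_less_0_iff)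
  next
    case 2
    obtain \<alpha> where "\<alpha> < min a1 aw" "\<alpha> \<notin> S"
      using real_below_avoiding[OF S] by blast
    then show ?thesis using 2
      by (intro exI[of _ \<alpha>] exI[of _ "(b1 + bw) / 2"]) (auto simp: zero_less_mult_iff mult_less_0_iff)
  next
    case 3
    obtain \<alpha> where "a1 < \<alpha>" "\<alpha> < aw" "\<alpha> \<notin> S"
      using real_between_avoiding[OF S 3] by blast
    then show ?thesis
      by (intro exI[of _ \<alpha>] exI[of _ "max b1 bw + 1"]) (auto simp: zero_less_mult_iff mult_less_0_iff)
  next
    case 4
    obtain \<alpha> where "aw < \<alpha>" "\<alpha> < a1" "\<alpha> \<notin> S"
      using real_between_avoiding[OF S 4] by blast
    then show ?thesis
      by (intro exI[of _ \<alpha>] exI[of _ "min b1 bw - 1"]) (auto simp: zero_less_mult_iff mult_less_0_iff)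
  qed
qed

text \<open>In the coordinate that separates \<open>w\<close> from the box choose a value strictly
  between them: it is on one side of both \<open>u1\<close> and \<open>u2\<close> and on the other
  side of \<open>w\<close>. The other coordinate lies beyond all three points, in the direction that
  makes \<open>u1\<close> and \<open>u2\<close> concordant with the new point.\<close>

lemma place_outside_box:
  fixes a1 b1 a2 b2 aw bw :: real
  assumes S: "finite S" and out: "aw < min a1 a2 \<or> max a1 a2 < aw \<or> bw < min b1 b2 \<or> max b1 b2 < bw"
  shows "\<exists>\<alpha> \<beta>. \<alpha> \<notin> S \<and> 0 < (\<alpha> - a1) * (\<beta> - b1) \<and> 0 < (\<alpha> - a2) * (\<beta> - b2) \<and>
    (\<alpha> - aw) * (\<beta> - bw) < 0"
proof -
  note sgn = zero_less_mult_iff mult_less_0_iff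
  from out consider "aw < min a1 a2" | "max a1 a2 < aw" | "bw < min b1 b2" | "max b1 b2 < bw" by blast
  then show ?thesis
  proof cases
    case 1
    obtain \<alpha> where "aw < \<alpha>" "\<alpha> < min a1 a2" "\<alpha> \<notin> S"
      using real_between_avoiding[OF S 1] by blast
    then show ?thesis
      by (intro exI[of _ \<alpha>] exI[of _ "min (min b1 b2) bw - 1"]) (auto simp: sgn)
  next
    case 2
    obtain \<alpha> where "max a1 a2 < \<alpha>" "\<alpha> < aw" "\<alpha> \<notin> S"
      using real_between_avoiding[OF S 2] by blast
    then show ?thesis
      by (intro exI[of _ \<alpha>] exI[of _ "max (max b1 b2) bw + 1"]) (auto simp: sgn)
  next
    case 3
    let ?m = "min (min a1 a2) aw"
    obtain \<alpha> where "\<alpha> < ?m" "\<alpha> \<notin> S"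
      using real_below_avoiding[OF S] by blast
    moreover obtain \<beta> where "bw < \<beta>" "\<beta> < min b1 b2" using dense[OF 3] by auto
    ultimately show ?thesis
      by (intro exI[of _ \<alpha>] exI[of _ \<beta>]) (auto simp: sgn)
  next
    case 4
    let ?m = "max (max a1 a2) aw"
    obtain \<alpha> where "?m < \<alpha>" "\<alpha> \<notin> S"
      using real_above_avoiding[OF S] by blast
    moreover obtain \<beta> where "max b1 b2 < \<beta>" "\<beta> < bw" using dense[OF 4] by auto
    ultimately show ?thesis
      by (intro exI[of _ \<alpha>] exI[of _ \<beta>]) (auto simp: sgn)
  qed
qed

text \<open>Every interior point of the box of a concordant pair is concordant with both of its
  ends. A \<open>w\<close> in the box that is neither end leaves interior room at its upper left or
  its lower right; a \<open>w\<close> outside is covered by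
  \<open>place_outside_box\<close>.\<close>

lemma place_three:
  fixes a1 b1 a2 b2 aw bw :: real
  assumes S: "finite S" and conc: "0 < (a1 - a2) * (b1 - b2)"
    and ne: "aw \<noteq> a1 \<or> bw \<noteq> b1" "aw \<noteq> a2 \<or> bw \<noteq> b2"
  shows "\<exists>\<alpha> \<beta>. \<alpha> \<notin> S \<and> 0 < (\<alpha> - a1) * (\<beta> - b1) \<and> 0 < (\<alpha> - a2) * (\<beta> - b2) \<and>
    (\<alpha> - aw) * (\<beta> - bw) < 0"
proof -
  note sgn = zero_less_mult_iff mult_less_0_iff
  have main: "\<exists>\<alpha> \<beta>. \<alpha> \<notin> S \<and> 0 < (\<alpha> - c1) * (\<beta> - d1) \<and> 0 < (\<alpha> - c2) * (\<beta> - d2) \<and>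
    (\<alpha> - aw) * (\<beta> - bw) < 0"
    if lt: "c1 < c2" "d1 < d2" and ne: "aw \<noteq> c1 \<or> bw \<noteq> d1" "aw \<noteq> c2 \<or> bw \<noteq> d2"
    for c1 d1 c2 d2 :: real
  proof -
    consider "aw < min c1 c2 \<or> max c1 c2 < aw \<or> bw < min d1 d2 \<or> max d1 d2 < bw"
      | "c1 < aw" "aw \<le> c2" "d1 \<le> bw" "bw < d2" | "c1 \<le> aw" "aw < c2" "d1 < bw" "bw \<le> d2"
      using lt ne by linarith
    then show ?thesis
    proof cases
      case 1
      then show ?thesis by (rule place_outside_box[OF S])
    next
      case 2
      obtain \<alpha> where "c1 < \<alpha>" "\<alpha> < aw" "\<alpha> \<notin> S"
        using real_between_avoiding[OF S 2(1)] by blast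
      moreover obtain \<beta> where "bw < \<beta>" "\<beta> < d2" using dense[OF 2(4)] by auto
      ultimately show ?thesis using 2
        by (intro exI[of _ \<alpha>] exI[of _ \<beta>]) (auto simp: sgn)
    next
      case 3
      obtain \<alpha> where "aw < \<alpha>" "\<alpha> < c2" "\<alpha> \<notin> S"
        using real_between_avoiding[OF S 3(2)] by blast
      moreover obtain \<beta> where "d1 < \<beta>" "\<beta> < bw" using dense[OF 3(3)] by auto
      ultimately show ?thesis using 3
        by (intro exI[of _ \<alpha>] exI[of _ \<beta>]) (auto simp: sgn)
    qed
  qed
  from conc consider "a1 < a2" "b1 < b2" | "a2 < a1" "b2 < b1" by (auto simp: sgn)
  then show ?thesis
    using main[of a1 a2 b1 b2] main[of a2 a1 b2 b1] ne by cases blast+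
qed

text \<open>For a new point joined to \<open>w\<close> by a double edge and placed level with it at
  height \<open>bw\<close>: only its side relative to the other neighbour remains to be
  chosen.\<close>

lemma place_tied:
  fixes aw b2 bw :: real
  assumes S: "finite S" and ne: "bw \<noteq> b2"
  shows "\<exists>\<alpha>. \<alpha> \<notin> S \<and> 0 < (\<alpha> - a2) * (bw - b2)"
proof -
  obtain \<alpha> where "a2 < \<alpha>" "\<alpha> \<notin> S"
      using real_above_avoiding[OF S] by blast
  moreover obtain \<alpha>' where "\<alpha>' < a2" "\<alpha>' \<notin> S"
      using real_below_avoiding[OF S] by blast
  ultimately show ?thesis using ne by (cases "bw < b2") (auto simp: zero_less_mult_iff)
qed

section \<open>Breaking a tie\<close>

lemma ex_gap:
  fixes a :: "'v \<Rightarrow> real"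
  assumes "finite V"
  obtains \<delta> where "\<delta> > 0" "\<And>p q. p \<in> V \<Longrightarrow> q \<in> V \<Longrightarrow> a p < a q \<Longrightarrow> a p + \<delta> < a q"
proof -
  \<comment> \<open>The inserted 1 keeps the set nonempty when \<open>a\<close> is constant on
    \<open>V\<close>; halving its minimum below makes the inequality strict.\<close>
  let ?M = "insert 1 ((\<lambda>(p, q). a q - a p) ` {(p, q). p \<in> V \<and> q \<in> V \<and> a p < a q})"
  have "{(p, q). p \<in> V \<and> q \<in> V \<and> a p < a q} \<subseteq> V \<times> V" by auto
  then have fin: "finite ?M" using assms by (meson finite_SigmaI finite_imageI finite_insert finite_subset)
  have pos: "0 < Min ?M" using fin by (subst Min_gr_iff) auto
  show thesis
  proof (rule that[of "Min ?M / 2"])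
    fix p q assume "p \<in> V" "q \<in> V" "a p < a q"
    then have "a q - a p \<in> ?M" by force
    then have "Min ?M \<le> a q - a p" using fin by (rule Min_le[rotated])
    then show "a p + Min ?M / 2 < a q" using pos by linarith
  qed (use pos in simp)
qed

text \<open>A shift smaller than every gap of \<open>a\<close> preserves strict inequalities, hence
  the signs along all single edges. The last conjunct records this so that positions relative to the
  tied pair can be carried over.\<close>

lemma layout_untie_fst:
  assumes V: "finite V" and l: "layout V (insert {x, y} E1) E2 a b"
    and e: "{x, y} \<in> E2" "{x, y} \<notin> E1" "x \<in> V" "y \<in> V" "x \<noteq> y"
    and sep: "\<not> joined E1 x y" and tie: "a x = a y"
  shows "\<exists>a'. layout V E1 E2 a' b \<and> (a' x - a' y) * (b x - b y) < 0 \<and>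
    (\<forall>p\<in>V. \<forall>q\<in>V. a p < a q \<longrightarrow> a' p < a' q)"
proof -
  obtain \<delta> where d: "\<delta> > 0" "\<And>p q. p \<in> V \<Longrightarrow> q \<in> V \<Longrightarrow> a p < a q \<Longrightarrow> a p + \<delta> < a q"
    using ex_gap[OF V] by blast
  \<comment> \<open>The direction is chosen to make the pair discordant: \<open>x\<close> moves up
    exactly if it has the smaller second coordinate.\<close>
  define t where "t = (if b x < b y then \<delta> else - \<delta>)"
  \<comment> \<open>All remaining tied pairs are edges of E1, so shifting a whole component of E1 keeps them tied.\<close>
  define a' where "a' z = (if joined E1 x z then a z + t else a z)" for z
  have mono: "a' p < a' q" if "p \<in> V" "q \<in> V" "a p < a q" for p q
    using d(2)[OF that] d(1) that(3) by (auto simp: a'_def t_def)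
  have "b x \<noteq> b y" using layoutD(1)[OF l e(3-5)] tie by simp
  then have neg: "(a' x - a' y) * (b x - b y) < 0"
    using sep tie d(1) by (auto simp: a'_def t_def mult_less_0_iff)
  then have neg': "(a' y - a' x) * (b y - b x) < 0" by (simp add: algebra_simps)
  have "layout V E1 E2 a' b"
  proof (rule layoutI)
    fix p q assume pq: "p \<in> V" "q \<in> V" "p \<noteq> q"
    note L = layoutD[OF l pq]
    show "a' p \<noteq> a' q \<or> b p \<noteq> b q"
      using L(1) mono[OF pq(1,2)] mono[OF pq(2,1)] by (cases "a p" "a q" rule: linorder_cases) auto
    show "0 < (a' p - a' q) * (b p - b q)" if "{p, q} \<in> E1" "{p, q} \<notin> E2"
      using L(2) that mono[OF pq(1,2)] mono[OF pq(2,1)] by (auto simp: zero_less_mult_iff)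
    show "(a' p - a' q) * (b p - b q) < 0" if "{p, q} \<in> E2" "{p, q} \<notin> E1"
    proof (cases "{p, q} = {x, y}")
      case True
      then show ?thesis using neg neg' by (auto simp: doubleton_eq_iff)
    next
      case False
      then show ?thesis
        using L(3) that mono[OF pq(1,2)] mono[OF pq(2,1)] by (auto simp: mult_less_0_iff)
    qed
    show "(a' p - a' q) * (b p - b q) = 0" if E: "{p, q} \<in> E1" "{p, q} \<in> E2"
    proof -
      have "joined E1 x p \<longleftrightarrow> joined E1 x q"
        using joined_edge[OF E(1)] joined_sym joined_trans by metis
      then show ?thesis using L(4) E by (auto simp: a'_def)
    qed
  qed
  then show ?thesis using neg mono by blast
qed

text \<open>A point differing from \<open>y\<close> in both coordinates lies strictly to one side of
  the tied value. The order-preserving shift keeps it on that side of both \<open>x\<close> and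
  \<open>y\<close>, hence outside their box.\<close>

lemma layout_untie:
  assumes V: "finite V" and l: "layout V (insert {x, y} E1) E2 a b"
    and e: "{x, y} \<in> E2" "{x, y} \<notin> E1" "x \<in> V" "y \<in> V" "x \<noteq> y"
    and sep: "\<not> joined E1 x y"
  obtains a' b' where "layout V E1 E2 a' b'" "(a' x - a' y) * (b' x - b' y) < 0"
    "\<And>w. w \<in> V \<Longrightarrow> (a w - a y) * (b w - b y) \<noteq> 0 \<Longrightarrow>
       a' w < min (a' x) (a' y) \<or> max (a' x) (a' y) < a' w \<or> b' w < min (b' x) (b' y) \<or> max (b' x) (b' y) < b' w"
proof -
  have "(a x - a y) * (b x - b y) = 0" using layoutD(4)[OF l e(3-5)] e(1) by simp
  then consider "a x = a y" | "b x = b y" by auto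
  then show thesis
  proof cases
    case 1
    obtain a' where a': "layout V E1 E2 a' b" "(a' x - a' y) * (b x - b y) < 0"
      "\<forall>p\<in>V. \<forall>q\<in>V. a p < a q \<longrightarrow> a' p < a' q"
      using layout_untie_fst[OF V l e sep 1] by blast
    show thesis
    proof (rule that[OF a'(1,2)])
      fix w assume w: "w \<in> V" "(a w - a y) * (b w - b y) \<noteq> 0"
      then have "a w < a x \<and> a w < a y \<or> a x < a w \<and> a y < a w" using 1 by auto
      then have "a' w < a' x \<and> a' w < a' y \<or> a' x < a' w \<and> a' y < a' w" using a'(3) w(1) e by blast
      then show "a' w < min (a' x) (a' y) \<or> max (a' x) (a' y) < a' w \<or>
        b w < min (b x) (b y) \<or> max (b x) (b y) < b w" by auto
    qed
  next
    case 2
    obtain b' where b': "layout V E1 E2 b' a" "(b' x - b' y) * (a x - a y) < 0"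
      "\<forall>p\<in>V. \<forall>q\<in>V. b p < b q \<longrightarrow> b' p < b' q"
      using layout_untie_fst[OF V layout_flip[OF l] e sep 2] by blast
    show thesis
    proof (rule that[OF layout_flip[OF b'(1)]])
      show "(a x - a y) * (b' x - b' y) < 0" using b'(2) by (simp add: mult.commute)
      fix w assume w: "w \<in> V" "(a w - a y) * (b w - b y) \<noteq> 0"
      then have "b w < b x \<and> b w < b y \<or> b x < b w \<and> b y < b w" using 2 by auto
      then have "b' w < b' x \<and> b' w < b' y \<or> b' x < b' w \<and> b' y < b' w" using b'(3) w(1) e by blast
      then show "a w < min (a x) (a y) \<or> max (a x) (a y) < a w \<or>
        b' w < min (b' x) (b' y) \<or> max (b' x) (b' y) < b' w" by auto
    qed
  qed
qed

section \<open>Inductive construction\<close>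

lemma incident_iff:
  assumes "{e\<in>F. v \<in> e} = {{v, u1}, {v, u2}}" "x \<noteq> v"
  shows "{v, x} \<in> F \<longleftrightarrow> x = u1 \<or> x = u2"
proof -
  have "{v, x} \<in> F \<longleftrightarrow> {v, x} \<in> {e\<in>F. v \<in> e}" by simp
  then show ?thesis unfolding assms(1) using assms(2) by (auto simp: doubleton_eq_iff)
qed

lemma layout_extend_incident:
  assumes l: "layout (V - {v}) {e\<in>E1. v \<notin> e} {e\<in>E2. v \<notin> e} a b"
    and inc1: "{e\<in>E1. v \<in> e} = {{v, u1}, {v, u2}}" and inc2: "{e\<in>E2. v \<in> e} = {{v, w}}"
    and new: "\<And>x. x \<in> V - {v} \<Longrightarrow> \<alpha> \<noteq> a x \<or> \<beta> \<noteq> b x"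
    and c: "u1 \<noteq> w \<Longrightarrow> 0 < (\<alpha> - a u1) * (\<beta> - b u1)" "u2 \<noteq> w \<Longrightarrow> 0 < (\<alpha> - a u2) * (\<beta> - b u2)"
      "w = u1 \<or> w = u2 \<Longrightarrow> (\<alpha> - a w) * (\<beta> - b w) = 0"
      "w \<noteq> u1 \<Longrightarrow> w \<noteq> u2 \<Longrightarrow> (\<alpha> - a w) * (\<beta> - b w) < 0"
  shows "\<exists>a b. layout V E1 E2 a b"
proof -
  have m: "{v, x} \<in> E1 \<longleftrightarrow> x = u1 \<or> x = u2" "{v, x} \<in> E2 \<longleftrightarrow> x = w" if "x \<in> V - {v}" for x
    using incident_iff[OF inc1, of x] incident_iff[of E2 v w w x] inc2 that by auto
  have "layout V E1 E2 (a(v := \<alpha>)) (b(v := \<beta>))"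
    by (rule layout_extend[OF l new]) (use m c in auto)
  then show ?thesis by blast
qed

section \<open>Reinserting the vertex of low degree\<close>

text \<open>The setting of the induction step: \<open>v\<close> is a leaf of the second tree
  attached to \<open>w\<close>. \<open>IH\<close> ranges over all pairs of trees on
  \<open>V - {v}\<close> because the first tree is reconnected in different ways.\<close>

locale low_degree_step =
  fixes V :: "'v set" and E1 E2 :: "'v set set" and v w :: 'v
  assumes t1: "stree V E1" and t2: "stree V E2" and v: "v \<in> V"
    and w: "w \<in> V" "w \<noteq> v" and inc2: "{e\<in>E2. v \<in> e} = {{v, w}}"
    and IH: "\<And>F1 F2. stree (V - {v}) F1 \<Longrightarrow> stree (V - {v}) F2 \<Longrightarrow> \<exists>a b. layout (V - {v}) F1 F2 a b"
begin

abbreviation "G1 \<equiv> {e\<in>E1. v \<notin> e}"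
abbreviation "G2 \<equiv> {e\<in>E2. v \<notin> e}"

lemma finite_V: "finite V"
  using t1 by (simp add: stree_def)

lemma G2_tree: "stree (V - {v}) G2"
  by (rule stree_leaf[OF t2 v w(2) inc2])

lemma degree_one:
  assumes u: "u \<in> V" "u \<noteq> v" and inc1: "{e\<in>E1. v \<in> e} = {{v, u}}"
  shows "\<exists>a b. layout V E1 E2 a b"
proof -
  obtain a b where l: "layout (V - {v}) G1 G2 a b"
    using IH[OF stree_leaf[OF t1 v u(2) inc1] G2_tree] by blast
  have inc1': "{e\<in>E1. v \<in> e} = {{v, u}, {v, u}}" using inc1 by simp
  show ?thesis
  proof (cases "u = w")
    case True
    \<comment> \<open>The two leaf edges are parallel: \<open>v\<close> copies the first coordinate
      of \<open>w\<close> and takes a fresh second one.\<close>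
    have "finite (b ` (V - {v}))" using finite_V by simp
    then obtain \<beta> where "\<beta> \<notin> b ` (V - {v})" using real_above_avoiding by blast
    then show ?thesis
      using True by (intro layout_extend_incident[OF l inc1' inc2, of "a w" \<beta>]) auto
  next
    case False
    have "a u \<noteq> a w \<or> b u \<noteq> b w" using layoutD(1)[OF l _ _ False] u w by auto
    moreover have "finite (a ` (V - {v}))" using finite_V by simp
    ultimately obtain \<alpha> \<beta> where "\<alpha> \<notin> a ` (V - {v})"
      "0 < (\<alpha> - a u) * (\<beta> - b u)" "(\<alpha> - a w) * (\<beta> - b w) < 0"
      using place_two by metis
    then show ?thesis
      using False by (intro layout_extend_incident[OF l inc1' inc2, of \<alpha> \<beta>]) auto
  qed
qed

context
  fixes u1 u2
  assumes u: "u1 \<in> V" "u2 \<in> V" "u1 \<noteq> v" "u2 \<noteq> v" "u1 \<noteq> u2"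
    and inc1: "{e\<in>E1. v \<in> e} = {{v, u1}, {v, u2}}"
begin

lemma ex_layout_add:
  assumes "x \<in> V" "x \<noteq> v" "joined G1 u1 x"
  shows "\<exists>a b. layout (V - {v}) (insert {x, u2} G1) G2 a b"
  using IH[OF stree_split(1)[OF t1 v u(3-5) inc1 assms] G2_tree] .

text \<open>The edge to \<open>w\<close> is double, so \<open>v\<close> is placed level with
  \<open>w\<close>; it can be made concordant with its other neighbour \<open>x\<close> because
  \<open>w\<close> and \<open>x\<close> are at different heights.\<close>

lemma ex_layout_tied:
  assumes l: "layout (V - {v}) G1 G2 a b" and ne: "b u1 \<noteq> b u2" and eq: "w = u1 \<or> w = u2"
  shows "\<exists>a b. layout V E1 E2 a b"
proof -
  define x where "x = (if w = u1 then u2 else u1)"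
  have fin: "finite (a ` (V - {v}))" using finite_V by simp
  have "b w \<noteq> b x" using ne eq by (auto simp: x_def)
  then obtain \<alpha> where "\<alpha> \<notin> a ` (V - {v})" "0 < (\<alpha> - a x) * (b w - b x)"
    using place_tied[OF fin] by blast
  then show ?thesis
    using eq u by (intro layout_extend_incident[OF l inc1 inc2, of \<alpha> "b w"]) (auto simp: x_def split: if_splits)
qed

lemma ex_layout_outside:
  assumes l: "layout (V - {v}) G1 G2 a b" and ne: "w \<noteq> u1" "w \<noteq> u2"
    and out: "a w < min (a u1) (a u2) \<or> max (a u1) (a u2) < a w \<or>
      b w < min (b u1) (b u2) \<or> max (b u1) (b u2) < b w"
  shows "\<exists>a b. layout V E1 E2 a b"
proof -
  have "finite (a ` (V - {v}))" using finite_V by simp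
  from place_outside_box[OF this out] obtain \<alpha> \<beta> where "\<alpha> \<notin> a ` (V - {v})"
    "0 < (\<alpha> - a u1) * (\<beta> - b u1)" "0 < (\<alpha> - a u2) * (\<beta> - b u2)" "(\<alpha> - a w) * (\<beta> - b w) < 0" by blast
  then show ?thesis
    using ne by (intro layout_extend_incident[OF l inc1 inc2, of \<alpha> \<beta>]) auto
qed

lemma degree_two_no_chord:
  assumes nE2: "{u1, u2} \<notin> E2"
  shows "\<exists>a b. layout V E1 E2 a b"
proof -
  obtain a b where l': "layout (V - {v}) (insert {u1, u2} G1) G2 a b"
    using ex_layout_add[OF u(1,3)] by auto
  have l: "layout (V - {v}) G1 G2 a b" by (rule layout_drop_edge[OF l']) (use nE2 in simp)
  have conc: "0 < (a u1 - a u2) * (b u1 - b u2)"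
    using layoutD(2)[OF l', of u1 u2] u nE2 by simp
  show ?thesis
  proof (cases "w = u1 \<or> w = u2")
    case True
    have "b u1 \<noteq> b u2" using conc by auto
    then show ?thesis by (rule ex_layout_tied[OF l _ True])
  next
    case False
    have "a w \<noteq> a u1 \<or> b w \<noteq> b u1" "a w \<noteq> a u2 \<or> b w \<noteq> b u2"
      using layoutD(1)[OF l, of w] u w False by auto
    moreover have "finite (a ` (V - {v}))" using finite_V by simp
    ultimately obtain \<alpha> \<beta> where "\<alpha> \<notin> a ` (V - {v})"
      "0 < (\<alpha> - a u1) * (\<beta> - b u1)" "0 < (\<alpha> - a u2) * (\<beta> - b u2)" "(\<alpha> - a w) * (\<beta> - b w) < 0"
      using place_three[OF _ conc] by metis
    then show ?thesis
      using False by (intro layout_extend_incident[OF l inc1 inc2, of \<alpha> \<beta>]) auto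
  qed
qed

text \<open>Both layouts are kept: the edge conditions of the tied one locate other vertices
  relative to \<open>u2\<close>, and the untied one receives \<open>v\<close>.\<close>

lemma ex_layout_untied:
  assumes E2: "{u1, u2} \<in> E2"
  obtains a b a' b' where "layout (V - {v}) (insert {u1, u2} G1) G2 a b"
    "layout (V - {v}) G1 G2 a' b'" "b' u1 \<noteq> b' u2"
    "\<And>x. x \<in> V - {v} \<Longrightarrow> (a x - a u2) * (b x - b u2) \<noteq> 0 \<Longrightarrow>
       a' x < min (a' u1) (a' u2) \<or> max (a' u1) (a' u2) < a' x \<or>
       b' x < min (b' u1) (b' u2) \<or> max (b' u1) (b' u2) < b' x"
proof -
  obtain a b where l: "layout (V - {v}) (insert {u1, u2} G1) G2 a b"
    using ex_layout_add[OF u(1,3)] by auto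
  \<comment> \<open>Otherwise \<open>v\<close>, \<open>u1\<close>, \<open>u2\<close> would form a
    triangle in the first tree.\<close>
  have "{u1, u2} \<notin> E1" by (rule stree_split(2)[OF t1 v u(3-5) inc1 u(1,3)]) simp
  then have prems: "finite (V - {v})" "{u1, u2} \<in> G2" "{u1, u2} \<notin> G1" "u1 \<in> V - {v}" "u2 \<in> V - {v}"
    using finite_V u E2 by simp_all
  show thesis
  proof (rule layout_untie[OF prems(1) l prems(2-5) u(5) stree_split_separated[OF t1 u(3-5) inc1]])
    fix a' b' assume l': "layout (V - {v}) G1 G2 a' b'" "(a' u1 - a' u2) * (b' u1 - b' u2) < 0"
      "\<And>x. x \<in> V - {v} \<Longrightarrow> (a x - a u2) * (b x - b u2) \<noteq> 0 \<Longrightarrow>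
         a' x < min (a' u1) (a' u2) \<or> max (a' u1) (a' u2) < a' x \<or>
         b' x < min (b' u1) (b' u2) \<or> max (b' u1) (b' u2) < b' x"
    have "b' u1 \<noteq> b' u2" using l'(2) by auto
    then show thesis by (rule that[OF l l'(1) _ l'(3)])
  qed
qed

text \<open>If {w, u2} is not an edge of E2, the new edge of the first tree is {w, u2} rather than
  {u1, u2}: with w, u2 concordant and u1, u2 discordant, w lies outside the box of u1, u2.\<close>

lemma degree_two_chord_side:
  assumes E2: "{u1, u2} \<in> E2" and ne: "w \<noteq> u1" "w \<noteq> u2" and side: "joined G1 u1 w"
  shows "\<exists>a b. layout V E1 E2 a b"
proof (cases "{w, u2} \<in> E2")
  case True
  obtain a b a' b' where l: "layout (V - {v}) (insert {u1, u2} G1) G2 a b"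
    "layout (V - {v}) G1 G2 a' b'" "b' u1 \<noteq> b' u2"
    "\<And>x. x \<in> V - {v} \<Longrightarrow> (a x - a u2) * (b x - b u2) \<noteq> 0 \<Longrightarrow>
       a' x < min (a' u1) (a' u2) \<or> max (a' u1) (a' u2) < a' x \<or>
       b' x < min (b' u1) (b' u2) \<or> max (b' u1) (b' u2) < b' x"
    by (rule ex_layout_untied[OF E2]) (rule that)
  \<comment> \<open>\<open>w\<close> and \<open>u2\<close> lie on different sides of the first tree,
    so their edge belongs to the second tree alone. They are thus discordant in the tied layout and
    differ in both coordinates.\<close>
  have "{w, u2} \<notin> E1" using stree_split(2)[OF t1 v u(3-5) inc1 w side] .
  then have "(a w - a u2) * (b w - b u2) < 0"
    using layoutD(3)[OF l(1), of w u2] u w ne True by (auto simp: doubleton_eq_iff)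
  then have "(a w - a u2) * (b w - b u2) \<noteq> 0" by (rule less_imp_neq)
  then show ?thesis by (intro ex_layout_outside[OF l(2) ne] l(4)) (use w in simp)
next
  case False
  obtain a b where l': "layout (V - {v}) (insert {w, u2} G1) G2 a b"
    using ex_layout_add[OF w side] by blast
  have l: "layout (V - {v}) G1 G2 a b" by (rule layout_drop_edge[OF l']) (use False in simp)
  have "{u1, u2} \<notin> E1" by (rule stree_split(2)[OF t1 v u(3-5) inc1 u(1,3)]) simp
  then have "(a u1 - a u2) * (b u1 - b u2) < 0"
    using layoutD(3)[OF l, of u1 u2] u E2 by simp
  moreover have "0 < (a w - a u2) * (b w - b u2)"
    using layoutD(2)[OF l', of w u2] u w ne False by simp
  \<comment> \<open>\<open>u2\<close> is the upper left or lower right corner of the box of the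
    discordant pair, and no point of that box is concordant with such a corner.\<close>
  ultimately have "a w < min (a u1) (a u2) \<or> max (a u1) (a u2) < a w \<or>
      b w < min (b u1) (b u2) \<or> max (b u1) (b u2) < b w"
    by (auto simp: zero_less_mult_iff mult_less_0_iff)
  then show ?thesis by (rule ex_layout_outside[OF l ne])
qed

lemma degree_two_tied_chord:
  assumes E2: "{u1, u2} \<in> E2" and eq: "w = u1 \<or> w = u2"
  shows "\<exists>a b. layout V E1 E2 a b"
  by (rule ex_layout_untied[OF E2]) (rule ex_layout_tied[OF _ _ eq])

end

lemma degree_two:
  assumes u: "u1 \<in> V" "u2 \<in> V" "u1 \<noteq> v" "u2 \<noteq> v" "u1 \<noteq> u2"
    and inc1: "{e\<in>E1. v \<in> e} = {{v, u1}, {v, u2}}"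
  shows "\<exists>a b. layout V E1 E2 a b"
proof (cases "{u1, u2} \<in> E2 \<and> w \<noteq> u1 \<and> w \<noteq> u2")
  case False
  then show ?thesis using degree_two_no_chord[OF u inc1] degree_two_tied_chord[OF u inc1] by blast
next
  case True
  have flip: "{u2, u1} \<in> E2" "{e\<in>E1. v \<in> e} = {{v, u2}, {v, u1}}"
    using True inc1 by (simp_all add: insert_commute)
  \<comment> \<open>\<open>w\<close> is on the side of \<open>u1\<close> or of \<open>u2\<close>;
    the second case is the first with the two neighbours exchanged.\<close>
  from stree_split_sides[OF t1 v inc1 w] show ?thesis
    using degree_two_chord_side[OF u inc1] True
      degree_two_chord_side[OF u(2,1,4,3) u(5)[symmetric] flip(2,1)] by blast
qed

end

lemma layout_step:
  assumes t: "stree V E1" "stree V E2" and v: "v \<in> V" and V2: "card V \<ge> 2"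
    and d: "card {e\<in>E2. v \<in> e} = 1" "card {e\<in>E1. v \<in> e} \<le> 2"
    and IH: "\<And>F1 F2. stree (V - {v}) F1 \<Longrightarrow> stree (V - {v}) F2 \<Longrightarrow> \<exists>a b. layout (V - {v}) F1 F2 a b"
  shows "\<exists>a b. layout V E1 E2 a b"
proof -
  obtain w where w: "w \<in> V" "w \<noteq> v" "{e\<in>E2. v \<in> e} = {{v, w}}"
    using incident_one[OF t(2) d(1)] by blast
  interpret low_degree_step V E1 E2 v w
    by (rule low_degree_step.intro[OF t v w IH])
  have "card {e\<in>E1. v \<in> e} = 1 \<or> card {e\<in>E1. v \<in> e} = 2"
    using stree_incident_nonempty[OF t(1) v V2] d(2) by linarith
  then show ?thesis
  proof
    assume "card {e\<in>E1. v \<in> e} = 1"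
    then show ?thesis by (rule incident_one[OF t(1)]) (rule degree_one)
  next
    assume "card {e\<in>E1. v \<in> e} = 2"
    then show ?thesis by (rule incident_two[OF t(1)]) (rule degree_two)
  qed
qed

lemma ex_layout:
  assumes "stree V E1" "stree V E2"
  shows "\<exists>a b. layout V E1 E2 a b"
  using assms
proof (induction "card V" arbitrary: V E1 E2 rule: less_induct)
  case less
  note t = less.prems
  have V: "finite V" "V \<noteq> {}" using t(1) by (auto simp: stree_def)
  show ?case
  proof (cases "card V \<ge> 2")
    case False
    moreover have "card V > 0" using V by (simp add: card_gt_0_iff)
    ultimately have "card V = 1" by linarith
    then obtain x where "V = {x}" by (rule card_1_singletonE)
    then have "layout V E1 E2 (\<lambda>_. 0) (\<lambda>_. 0)" by (simp add: layout_def)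
    then show ?thesis by blast
  next
    case True
    obtain v where v: "v \<in> V" "card {e\<in>E1. v \<in> e} + card {e\<in>E2. v \<in> e} \<le> 3"
      using ex_low_degree[OF t] by blast
    have "card (V - {v}) < card V" using V(1) v(1) by (rule card_Diff1_less)
    note IH = less.hyps[OF this]
    have "card {e\<in>E1. v \<in> e} \<ge> 1" "card {e\<in>E2. v \<in> e} \<ge> 1"
      using stree_incident_nonempty[OF _ v(1) True] t by blast+
    then consider "card {e\<in>E2. v \<in> e} = 1" "card {e\<in>E1. v \<in> e} \<le> 2"
      | "card {e\<in>E1. v \<in> e} = 1" "card {e\<in>E2. v \<in> e} \<le> 2" using v(2) by linarith
    then show ?thesis
    proof cases
      case 1
      then show ?thesis using layout_step[OF t v(1) True _ _ IH] by blast
    next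
      case 2
      then have "\<exists>a b. layout V E2 E1 a b" using layout_step[OF t(2,1) v(1) True _ _ IH] by blast
      then show ?thesis using layout_negate by blast
    qed
  qed
qed

section \<open>From layouts to realisations\<close>

lemma connected_in_eq_joined: "connected_in ends F = joined (ends ` F)"
proof -
  have "adj_in ends F = (\<lambda>x y. {x, y} \<in> ends ` F)" by (auto simp: adj_in_def fun_eq_iff)
  then show ?thesis unfolding connected_in_def joined_def by simp
qed

text \<open>Of two parallel edges in a tree, either would still join the ends of the other after its
  removal.\<close>

lemma spanning_tree_inj:
  assumes m: "multigraph V E ends" and t: "spanning_tree V E ends T"
  shows "inj_on ends T"
proof (rule inj_onI, rule ccontr)
  fix e e' assume e: "e \<in> T" "e' \<in> T" "ends e = ends e'" "e \<noteq> e'"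
  have "card (ends e) = 2" using m t e by (auto simp: multigraph_def spanning_tree_def)
  then obtain x y where xy: "ends e = {x, y}" by (auto simp: card_2_iff)
  have "{x, y} \<in> ends ` (T - {e})" using xy e by (metis Diff_iff image_eqI singletonD)
  then have "connected_in ends (T - {e}) x y" by (simp add: connected_in_eq_joined joined_edge)
  then show False using t e xy by (auto simp: spanning_tree_def)
qed

text \<open>A spanning subset with the right number of edges must be the whole tree, since an edge
  outside it would not be a bridge.\<close>

lemma spanning_tree_stree:
  assumes m: "multigraph V E ends" and t: "spanning_tree V E ends T"
  shows "stree V (ends ` T)"
proof -
  note inj = spanning_tree_inj[OF m t]
  have V: "finite V" "V \<noteq> {}" using m t by (auto simp: multigraph_def spanning_tree_def)
  have edges: "\<forall>e\<in>ends ` T. e \<subseteq> V \<and> card e = 2"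
    using m t by (auto simp: multigraph_def spanning_tree_def)
  have conn: "\<forall>u\<in>V. \<forall>w\<in>V. joined (ends ` T) u w"
    using t by (auto simp: spanning_tree_def connected_in_eq_joined)
  obtain S where S: "S \<subseteq> ends ` T" "\<forall>u\<in>V. \<forall>w\<in>V. joined S u w" "card S + 1 = card V"
    using ex_spanning_subset[OF V, of "ends ` T"] edges conn by blast
  have "S = ends ` T"
  proof (rule ccontr)
    assume "S \<noteq> ends ` T"
    then obtain e where e: "e \<in> T" "ends e \<notin> S" using S(1) by blast
    then obtain x y where xy: "ends e = {x, y}" "x \<in> V" "y \<in> V"
      using edges by (force simp: card_2_iff)
    have "S \<subseteq> ends ` (T - {e})" using S(1) e(2) by blast
    then have "connected_in ends (T - {e}) x y"
      using S(2) xy joined_mono by (metis connected_in_eq_joined)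
    then show False using t e xy by (auto simp: spanning_tree_def)
  qed
  then show ?thesis using V edges conn S(3) by (simp add: stree_def)
qed

section \<open>Colours in the plane and the realisation\<close>

lemma framework_colours_plane:
  fixes x y :: "real^2"
  shows "1 \<in> framework_colours x y \<longleftrightarrow> \<bar>(x - y) $ 2\<bar> \<le> \<bar>(x - y) $ 1\<bar>"
    and "2 \<in> framework_colours x y \<longleftrightarrow> \<bar>(x - y) $ 1\<bar> \<le> \<bar>(x - y) $ 2\<bar>"
proof -
  have "linf (x - y) = max \<bar>(x - y) $ 1\<bar> \<bar>(x - y) $ 2\<bar>"
    unfolding linf_def UNIV_2 by simp
  then show "1 \<in> framework_colours x y \<longleftrightarrow> \<bar>(x - y) $ 2\<bar> \<le> \<bar>(x - y) $ 1\<bar>"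
    "2 \<in> framework_colours x y \<longleftrightarrow> \<bar>(x - y) $ 1\<bar> \<le> \<bar>(x - y) $ 2\<bar>"
    by (auto simp: framework_colours_def)
qed

lemma abs_le_iff_rotated:
  fixes s t :: real
  shows "\<bar>s - t\<bar> \<le> \<bar>s + t\<bar> \<longleftrightarrow> 0 \<le> s * t" and "\<bar>s + t\<bar> \<le> \<bar>s - t\<bar> \<longleftrightarrow> s * t \<le> 0"
proof -
  have "(s + t)\<^sup>2 - (s - t)\<^sup>2 = 4 * (s * t)" by (simp add: power2_eq_square algebra_simps)
  then show "\<bar>s - t\<bar> \<le> \<bar>s + t\<bar> \<longleftrightarrow> 0 \<le> s * t" "\<bar>s + t\<bar> \<le> \<bar>s - t\<bar> \<longleftrightarrow> s * t \<le> 0"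
    unfolding abs_le_square_iff by linarith+
qed

theorem theorem4p3:
  fixes V :: "'v set" and E :: "'e set" and ends :: "'e \<Rightarrow> 'v set"
    and T :: "2 \<Rightarrow> 'e set"
  assumes "tree_decomposition V E ends T"
  shows "\<exists>p :: 'v \<Rightarrow> real^2. realisation V E ends T p"
proof -
  have m: "multigraph V E ends" and t: "\<And>i. spanning_tree V E ends (T i)"
    and disj: "T 1 \<inter> T 2 = {}" and E: "E = T 1 \<union> T 2"
    using assms by (auto simp: tree_decomposition_def UNIV_2)
  obtain a b where l: "layout V (ends ` T 1) (ends ` T 2) a b"
    using ex_layout spanning_tree_stree[OF m t] by blast
  \<comment> \<open>This undoes the rotation up to a factor, which leaves the comparison of
    coordinates unchanged.\<close>
  define p :: "'v \<Rightarrow> real^2" where "p x = vector [a x + b x, a x - b x]" for x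
  define \<kappa> :: "'e \<Rightarrow> 2" where "\<kappa> e = (if e \<in> T 1 then 1 else 2)" for e
  have \<kappa>: "\<kappa> e = i" if "e \<in> T i" for e i
    using that disj exhaust_2[of i] by (auto simp: \<kappa>_def)
  have colours: "1 \<in> framework_colours (p u) (p w) \<longleftrightarrow> 0 \<le> (a u - a w) * (b u - b w)"
    "2 \<in> framework_colours (p u) (p w) \<longleftrightarrow> (a u - a w) * (b u - b w) \<le> 0" for u w
    using abs_le_iff_rotated[of "a u - a w" "b u - b w"]
    by (simp_all add: framework_colours_plane p_def algebra_simps)
  have bij: "bij_betw \<kappa> (edges_between E ends u w) (framework_colours (p u) (p w))"
    if uw: "u \<in> V" "w \<in> V" "u \<noteq> w" "edges_between E ends u w \<noteq> {}" for u w
  proof -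
    note L = layoutD[OF l uw(1-3)]
    have ex: "i \<in> \<kappa> ` edges_between E ends u w \<longleftrightarrow> {u, w} \<in> ends ` T i" for i
      using \<kappa> E exhaust_2[of i] by (fastforce simp: edges_between_def)
    have "{u, w} \<in> ends ` T 1 \<or> {u, w} \<in> ends ` T 2"
      using uw(4) E by (force simp: edges_between_def)
    \<comment> \<open>A positive product gives colour 1 only, a negative one colour 2 only and zero
      both, matching edges of the first tree only, the second only and both.\<close>
    then have "i \<in> framework_colours (p u) (p w) \<longleftrightarrow> {u, w} \<in> ends ` T i" for i
      using L(2-4) colours[of u w] exhaust_2[of i] by (smt (verit))
    then have "\<kappa> ` edges_between E ends u w = framework_colours (p u) (p w)" using ex by blast
    moreover have "inj_on \<kappa> (edges_between E ends u w)"
    proof (rule inj_onI)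
      fix e e' assume e: "e \<in> edges_between E ends u w" "e' \<in> edges_between E ends u w" "\<kappa> e = \<kappa> e'"
      then obtain i j where "e \<in> T i" "e' \<in> T j" "ends e = ends e'"
        using E by (auto simp: edges_between_def)
      \<comment> \<open>Edges of equal colour lie in the same tree, which has no parallel
        edges.\<close>
      then show "e = e'" using \<kappa> e(3) spanning_tree_inj[OF m t] by (metis inj_onD)
    qed
    ultimately show ?thesis by (simp add: bij_betw_def)
  qed
  have "inj_on p V"
  proof (rule inj_onI, rule ccontr)
    fix u w assume uw: "u \<in> V" "w \<in> V" "p u = p w" "u \<noteq> w"
    have "p u $ 1 = p w $ 1" "p u $ 2 = p w $ 2" using uw(3) by simp_all
    then have "a u + b u = a w + b w" "a u - b u = a w - b w" by (simp_all add: p_def)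
    then show False using layoutD(1)[OF l uw(1,2,4)] by linarith
  qed
  moreover have "well_positioned V E ends p"
    using bij_betw_same_card[OF bij] by (simp add: well_positioned_def)
  moreover have "framework_colouring V E ends p \<kappa>"
    using bij by (simp add: framework_colouring_def)
  moreover have "\<forall>i. {e\<in>E. \<kappa> e = i} = T i"
  proof
    fix i
    show "{e\<in>E. \<kappa> e = i} = T i" using \<kappa> E exhaust_2[of i] by auto
  qed
  ultimately show ?thesis unfolding realisation_def by blast
qed

end
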